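(* Let $U=(U_y)_{y\in\mathbb{Z}}$ and $V=(V_x)_{x\in\mathbb{Z}}$ be families of random variables with values in $\{-1,1\}$, all independent, each equal to $+1$ or $-1$ with probability $1/2$. Let $\omega$ be the directed graph with vertex set $\mathbb{Z}^2$ and edge set $\{((x,y),(x+U_y,y+V_x)) : (x,y)\in\mathbb{Z}^2\}$. Then, almost surely, every connected component of $\omega$ is bounded and contains exactly one trap.
   Context: A trap is a pair of opposite edges $(a,b),(b,a)$ both belonging to $\omega$ (equivalently, a directed cycle of length 2 in $\omega$). Connected components are those of the underlying undirected graph. *)

theory Defs
  imports
    "HOL-Probability.Probability"
    "Graph_Theory.Digraph_Component"
begin

definition lattice_digraph :: "(int \<Rightarrow> int) \<Rightarrow> (int \<Rightarrow> int) \<Rightarrow> (int \<times> int) pair_pre_digraph" where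
  "lattice_digraph u v =
     \<lparr> pverts = UNIV, parcs = {((x, y), (x + u y, y + v x)) | x y. True} \<rparr>"

text \<open>A component is kept as a subgraph of the digraph itself, with its orientation; connectivity
  refers to the underlying undirected graph. The qualified name is needed because
  \<open>connected\<close> also denotes topological connectedness of sets.\<close>

definition digraph_components :: "'a pair_pre_digraph \<Rightarrow> ('a, 'a \<times> 'a) pre_digraph set" where
  "digraph_components G = {H. pre_digraph.max_subgraph (with_proj G) Digraph_Component.connected H}"

text \<open>A trap is an unordered pair of arcs, so \<open>(a, b), (b, a)\<close> and \<open>(b, a), (a, b)\<close>
  are the same trap.\<close>

definition traps :: "'a pair_pre_digraph \<Rightarrow> ('a \<times> 'a) set set" where
  "traps G = {{(a, b), (b, a)} | a b. a \<noteq> b \<and> (a, b) \<in> parcs G \<and> (b, a) \<in> parcs G}"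

end

theory Submission
  imports Defs
begin

text \<open>Every vertex has exactly one outgoing arc, so the graph is that of a walk on \<open>\<int>\<^sup>2\<close> with
  \<open>(x, y) \<mapsto> (x + u y, y + v x)\<close>, and a trap is a cycle of length two of this map. Three facts give the
  result.

  First, there are no longer cycles, whatever the signs are (\<open>periodic_walk_trapped\<close>). The walk is a
  discrete Hamiltonian flow, and the change of its energy \<open>A(x) - B(y)\<close> counts the turns of the walk, left
  minus right quarter turns. On a cycle the energy returns to its value, so the total turning is zero; but a
  cycle longer than two is a simple closed curve and makes a full turn.

  Secondly, almost surely every walk ends in a trap (\<open>AE_eventually_trapped\<close>). Explore the signs
  along the walk. Whenever signs not seen before decide whether the walk goes straight back after its
  next step, it does so with probability at least \<open>1/4\<close>. As this can succeed only once, almost surely there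
  are finitely many such trials (\<open>AE_finite_trials\<close>). On the other hand an unbounded walk has infinitely
  many: having reached a new column, it passes through one new column after the other until a trial
  occurs, and if none did, it would do so within finitely many rows, which long runs of equal
  signs forbid (\<open>finite_columns\<close>). Hence the walk is bounded, thus eventually periodic, and the first fact
  applies.

  Thirdly, almost surely each trap is reached from finitely many vertices (\<open>AE_finite_first_trapped\<close>):
  by translation invariance, the expected number of vertices whose first trapped vertex is a given one
  equals the expected number of first trapped vertices of the origin, which is at most one.

  A component then consists of the vertices that are led to one trap, so it is finite and contains no
  other trap (\<open>component_bounded_one_trap\<close>).

  The probability estimates use measure-preserving sign flips and disjointness of events
  (\<open>prob_le_if_flip\<close>, \<open>AE_finite_dominated\<close>) in place of conditioning.\<close>

section \<open>The turning number of a closed lattice curve\<close>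

lemma abs_one_cases: "\<bar>a\<bar> = 1 \<longleftrightarrow> a = 1 \<or> a = (-1::int)"
  by auto

text \<open>Signed crossings of the positive horizontal half-axis by a diagonal unit step from \<open>w\<close> to
  \<open>w'\<close>, counter-clockwise counted \<open>+1\<close>. The half-axis is treated as belonging to the upper half
  plane, so the step has to connect the heights \<open>-1\<close> and \<open>0\<close>. Summed along a closed path of non-zero
  vectors this is the winding number around the origin.\<close>

definition ray_crossing :: "int \<times> int \<Rightarrow> int \<times> int \<Rightarrow> int" where
  "ray_crossing w w' =
     (if snd w = -1 \<and> snd w' = 0 \<and> 0 < fst w' then 1 else 0)
     - (if snd w = 0 \<and> snd w' = -1 \<and> 0 < fst w then 1 else 0)"

text \<open>The crossing number is a closed cochain: the four vectors are the corners of a (possibly degenerate)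
  unit cell of the diagonal lattice through the origin. Such a cell has no lattice point in its
  interior, so if the origin is not a corner, the boundary does not wind around it.\<close>

lemma ray_crossing_square:
  fixes p q a b c d :: int
  assumes "\<bar>a\<bar> = 1" "\<bar>b\<bar> = 1" "\<bar>c\<bar> = 1" "\<bar>d\<bar> = 1" "even (p + q)"
    and "(p, q) \<noteq> (0, 0)" "(p + a, q + b) \<noteq> (0, 0)" "(p - c, q - d) \<noteq> (0, 0)"
    and "(p + a - c, q + b - d) \<noteq> (0, 0)"
  shows "ray_crossing (p, q) (p + a, q + b) + ray_crossing (p + a, q + b) (p + a - c, q + b - d)
    = ray_crossing (p, q) (p - c, q - d) + ray_crossing (p - c, q - d) (p + a - c, q + b - d)"
proof -
  (* With the parity built into p, only the heights next to the half-axis matter, and each of them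
     leaves a linear problem. *)
  obtain k where k: "p = 2 * k - q" using assms(5) by (metis add_diff_cancel_right' evenE)
  show ?thesis
  proof (cases "q \<in> {-2, -1, 0, 1}")
    case True
    then show ?thesis using assms(1-4,6-) unfolding abs_one_cases k
      by (elim disjE insertE emptyE; simp add: ray_crossing_def; linarith?)
  next
    case False
    then show ?thesis using assms(1-4) unfolding abs_one_cases
      by (elim disjE; simp add: ray_crossing_def)
  qed
qed

definition quadrant :: "int \<times> int \<Rightarrow> int" where
  "quadrant d = (if d = (1, 1) then 0 else if d = (-1, 1) then 1 else if d = (-1, -1) then 2 else 3)"

text \<open>For two consecutive diagonal steps that do not cancel, the cross product is twice the signed number of
  quarter turns. That number is the change of quadrant, corrected by \<open>4\<close> whenever the direction passes
  the half-axis on its way; the direction moves through the sum of the two steps, which lies between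
  them.\<close>

lemma turn_eq_ray_crossing:
  assumes "\<bar>a\<bar> = 1" "\<bar>b\<bar> = 1" "\<bar>c\<bar> = 1" "\<bar>d\<bar> = 1" "(a + c, b + d) \<noteq> (0, 0)"
  shows "a * d - b * c = 2 * (quadrant (c, d) - quadrant (a, b)
    + 4 * (ray_crossing (a, b) (a + c, b + d) + ray_crossing (a + c, b + d) (c, d)))"
  using assms unfolding abs_one_cases
  by (elim disjE; simp add: ray_crossing_def quadrant_def)

text \<open>A discrete form of Hopf's theorem on turning tangents: a simple closed lattice curve makes a full
  turn. As in the classical proof, one looks at the secants \<open>w s t\<close> from time \<open>s\<close> to time \<open>t\<close>, for
  \<open>0 \<le> s < t \<le> n\<close>; simplicity makes them non-zero, except for \<open>w 0 n\<close>. The crossings of the directions of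
  the curve are those along the staircase next to the diagonal \<open>s = t\<close>. Since the crossing number is
  closed, the staircase may be pushed away from the diagonal to the two legs \<open>s = 0\<close> and \<open>t = n\<close> of the
  triangle. If the curve starts at its leftmost lowest point, the secants on each leg stay in a half
  plane and give no crossing, so that only the corner of the triangle contributes, by \<open>\<plusminus>1\<close>.\<close>

lemma closed_lattice_curve_turns:
  fixes x y :: "nat \<Rightarrow> int"
  assumes dx: "\<And>t. \<bar>x (Suc t) - x t\<bar> = 1" and dy: "\<And>t. \<bar>y (Suc t) - y t\<bar> = 1"
    and px: "\<And>t. x (t + n) = x t" and py: "\<And>t. y (t + n) = y t"
    and n: "3 \<le> n"
    and inj: "\<And>s t. s < t \<Longrightarrow> t < s + n \<Longrightarrow> (x s, y s) \<noteq> (x t, y t)"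
    and low: "\<And>t. y 0 \<le> y t" and left: "\<And>t. y t = y 0 \<Longrightarrow> x 0 \<le> x t"
  shows "(\<Sum>t<n. (x (Suc t) - x t) * (y (Suc (Suc t)) - y (Suc t))
              - (y (Suc t) - y t) * (x (Suc (Suc t)) - x (Suc t))) \<noteq> 0"
proof -
  define w where "w s t = (x t - x s, y t - y s)" for s t
  define P where "P s t = ray_crossing (w s t) (w s (Suc t))" for s t
  define Q where "Q s t = ray_crossing (w s t) (w (Suc s) t)" for s t
  define D where "D s = P s (Suc s) + Q s (Suc (Suc s))" for s
  define G where "G s m = (\<Sum>t=Suc s..<m. P s t)" for s m
  have nz: "w s t \<noteq> (0, 0)" if "s < t" "t < s + n" for s t
    using inj[OF that] by (auto simp: w_def)
  have ev: "even (x t - x s + (y t - y s))" for s t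
  proof -
    have "even (x t + y t) = even (x 0 + y 0)" for t
    proof (induction t)
      case (Suc t)
      have "x (Suc t) + y (Suc t) = x t + y t + ((x (Suc t) - x t) + (y (Suc t) - y t))" by simp
      moreover have "even ((x (Suc t) - x t) + (y (Suc t) - y t))"
        using dx[of t] dy[of t] by presburger
      ultimately show ?case using Suc by (metis even_add)
    qed simp
    then show ?thesis by (metis add_diff_add even_diff even_add)
  qed
  (* The closedness of the crossing number on one cell of the triangle, and summed over a strip. *)
  have square: "P s t + Q s (Suc t) = Q s t + P (Suc s) t" if "Suc s < t" "Suc t < s + n" for s t
  proof -
    have "(x t - x s, y t - y s) \<noteq> (0, 0)"
      "(x t - x s + (x (Suc t) - x t), y t - y s + (y (Suc t) - y t)) \<noteq> (0, 0)"
      "(x t - x s - (x (Suc s) - x s), y t - y s - (y (Suc s) - y s)) \<noteq> (0, 0)"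
      "(x t - x s + (x (Suc t) - x t) - (x (Suc s) - x s),
        y t - y s + (y (Suc t) - y t) - (y (Suc s) - y s)) \<noteq> (0, 0)"
      using that nz[of s t] nz[of s "Suc t"] nz[of "Suc s" t] nz[of "Suc s" "Suc t"]
      by (simp_all add: w_def)
    from ray_crossing_square[OF dx[of t] dy[of t] dx[of s] dy[of s] ev this]
    show ?thesis by (simp add: P_def Q_def w_def)
  qed
  have strip: "G s m + Q s m = D s + G (Suc s) m" if "Suc (Suc s) \<le> m" "m < s + n" for s m
    using that
  proof (induction m rule: dec_induct)
    case base
    then show ?case by (simp add: G_def D_def)
  next
    case (step m)
    then show ?case using square[of s m] by (simp add: G_def)
  qed
  have sum_D: "(\<Sum>s=1..<n-1. D s) = G 1 n + (\<Sum>s=1..<n-1. Q s n)"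
  proof -
    have "(\<Sum>s=1..<n-1. D s) = (\<Sum>s=1..<n-1. Q s n - (G (Suc s) n - G s n))"
      by (rule sum.cong) (use strip[of _ n] in \<open>force simp: algebra_simps\<close>)+
    also have "\<dots> = (\<Sum>s=1..<n-1. Q s n) - (G (n - 1) n - G 1 n)"
      using sum_Suc_diff'[of 1 "n - 1" "\<lambda>s. G s n"] n by (simp only: sum_subtractf)
    also have "G (n - 1) n = 0" using n by (simp add: G_def)
    finally show ?thesis by simp
  qed
  have D0: "D 0 + G 1 (n - 1) = G 0 (n - 1) + Q 0 (n - 1)"
    using strip[of 0 "n - 1"] n by simp
  have G1: "G 1 n = G 1 (n - 1) + P 1 (n - 1)"
  proof -
    from n obtain k where "n = Suc k" "2 \<le> k" by (cases n) auto
    then show ?thesis by (simp add: G_def)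
  qed
  have G0: "G 0 (n - 1) = 0"
    unfolding G_def
  proof (rule sum.neutral, rule ballI)
    fix t
    show "P 0 t = 0"
      using low[of t] low[of "Suc t"] by (auto simp: P_def w_def ray_crossing_def)
  qed
  have zn: "x n = x 0" "y n = y 0" "x (Suc n) = x 1" "y (Suc n) = y 1"
    using px[of 0] py[of 0] px[of 1] py[of 1] by simp_all
  have Qn: "(\<Sum>s=1..<n-1. Q s n) = 0"
  proof (rule sum.neutral, rule ballI)
    fix s
    show "Q s n = 0"
      using left[of s] left[of "Suc s"] by (auto simp: Q_def w_def ray_crossing_def zn)
  qed
  (* At the lowest point the curve comes down with step (e, -1) and, as it is simple, leaves with
     step (e, 1); the crossings near the corner of the triangle sum up to e. *)
  define e where "e = x n - x (n - 1)"
  obtain k where k: "n = Suc k" "2 \<le> k" using n by (cases n) auto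
  have e1: "\<bar>e\<bar> = 1" using dx[of k] k by (simp add: e_def)
  have ey: "y n - y (n - 1) = -1" using dy[of k] low[of k] k zn by auto
  have y1: "y 1 - y 0 = 1" using dy[of 0] low[of 1] by auto
  have x1: "x 1 - x 0 = e"
    using nz[of 1 k] k ey y1 e1 dx[of 0] zn by (auto simp: w_def e_def)
  have "D (n - 1) + Q 0 (n - 1) + P 1 (n - 1) = e"
    using e1 ey y1 x1 k zn unfolding D_def P_def Q_def w_def ray_crossing_def e_def by auto
  then have D: "(\<Sum>s<n. D s) \<noteq> 0"
  proof -
    have "{..<n} = {0, n - 1} \<union> {1..<n-1}" using n by auto
    then have "(\<Sum>s<n. D s) = D 0 + D (n - 1) + (\<Sum>s=1..<n-1. D s)"
      using n by (simp add: sum.union_disjoint)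
    with sum_D D0 G1 G0 Qn \<open>D (n - 1) + Q 0 (n - 1) + P 1 (n - 1) = e\<close> e1 show ?thesis by auto
  qed
  define q where "q t = quadrant (x (Suc t) - x t, y (Suc t) - y t)" for t
  have turn: "(x (Suc t) - x t) * (y (Suc (Suc t)) - y (Suc t))
              - (y (Suc t) - y t) * (x (Suc (Suc t)) - x (Suc t)) = 2 * (q (Suc t) - q t + 4 * D t)" for t
    using turn_eq_ray_crossing[OF dx[of t] dy[of t] dx[of "Suc t"] dy[of "Suc t"]]
      nz[of t "Suc (Suc t)"] n
    by (simp add: w_def q_def D_def P_def Q_def)
  have "(\<Sum>t<n. 2 * (q (Suc t) - q t + 4 * D t)) = 2 * ((q n - q 0) + 4 * (\<Sum>t<n. D t))"
    using sum_lessThan_telescope[of q n]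
    by (simp only: sum_distrib_left[symmetric] sum.distrib)
  also have "q n = q 0" by (simp add: q_def zn)
  finally show ?thesis using D by (simp add: turn)
qed

section \<open>Periodic walks\<close>

definition step :: "(int \<Rightarrow> int) \<Rightarrow> (int \<Rightarrow> int) \<Rightarrow> int \<times> int \<Rightarrow> int \<times> int" where
  "step u v p = (fst p + u (snd p), snd p + v (fst p))"

abbreviation walk :: "(int \<Rightarrow> int) \<Rightarrow> (int \<Rightarrow> int) \<Rightarrow> int \<times> int \<Rightarrow> nat \<Rightarrow> int \<times> int" where
  "walk u v p t \<equiv> (step u v ^^ t) p"

definition trapped :: "(int \<Rightarrow> int) \<Rightarrow> (int \<Rightarrow> int) \<Rightarrow> int \<times> int \<Rightarrow> bool" where
  "trapped u v p \<longleftrightarrow> step u v (step u v p) = p"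

lemma ex_primitive:
  fixes g :: "int \<Rightarrow> int"
  shows "\<exists>A. \<forall>x. A (x + 1) - A x = g x"
proof -
  define A where "A x = sum g {0..<x} - sum g {x..<0}" for x
  have "A (x + 1) - A x = g x" for x
  proof (cases "0 \<le> x")
    case True
    then have "{0..<x + 1} = insert x {0..<x}" by auto
    with True show ?thesis by (simp add: A_def)
  next
    case False
    then have "{x..<0} = insert x {x + 1..<0}" by auto
    with False show ?thesis by (simp add: A_def)
  qed
  then show ?thesis by blast
qed

text \<open>The walk is a discrete Hamiltonian flow. For a function \<open>A\<close> of the column with increments
  \<open>v x + v (x + 1)\<close> and a function \<open>B\<close> of the row with increments \<open>u y + u (y + 1)\<close>, the quantity
  \<open>A - B\<close> is not quite conserved; its change over one step is the cross product of that step with the next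
  one. So \<open>A - B\<close> records how much the walk has turned, and it returns to its value on a closed walk.\<close>

lemma sum_turns_closed_walk:
  fixes u v :: "int \<Rightarrow> int" and x y :: "nat \<Rightarrow> int"
  assumes u: "\<And>y. \<bar>u y\<bar> = 1" and v: "\<And>x. \<bar>v x\<bar> = 1"
    and x: "\<And>t. x (Suc t) = x t + u (y t)" and y: "\<And>t. y (Suc t) = y t + v (x t)"
    and closed: "x n = x 0" "y n = y 0"
  shows "(\<Sum>t<n. u (y t) * v (x (Suc t)) - v (x t) * u (y (Suc t))) = 0"
proof -
  obtain A where A: "\<And>a. A (a + 1) - A a = v a + v (a + 1)"
    using ex_primitive[of "\<lambda>a. v a + v (a + 1)"] by auto
  obtain B where B: "\<And>b. B (b + 1) - B b = u b + u (b + 1)"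
    using ex_primitive[of "\<lambda>b. u b + u (b + 1)"] by auto
  define H where "H t = A (x t) - B (y t)" for t
  have "u (y t) * v (x (Suc t)) - v (x t) * u (y (Suc t)) = H (Suc t) - H t" for t
  proof -
    have "A (x (Suc t)) - A (x t) = u (y t) * (v (x t) + v (x (Suc t)))"
      using u[of "y t"] A[of "x t"] A[of "x t - 1"] by (auto simp: x abs_if split: if_splits)
    moreover have "B (y (Suc t)) - B (y t) = v (x t) * (u (y t) + u (y (Suc t)))"
      using v[of "x t"] B[of "y t"] B[of "y t - 1"] by (auto simp: y abs_if split: if_splits)
    ultimately show ?thesis by (simp add: H_def algebra_simps)
  qed
  then have "(\<Sum>t<n. u (y t) * v (x (Suc t)) - v (x t) * u (y (Suc t))) = H n - H 0"
    by (simp add: sum_lessThan_telescope)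
  also have "\<dots> = 0" by (simp add: H_def closed)
  finally show ?thesis .
qed

text \<open>A periodic walk of minimal period at least \<open>3\<close> traces a simple closed curve. It would have total turning
  zero by \<open>sum_turns_closed_walk\<close> and a full turn by \<open>closed_lattice_curve_turns\<close>. Period \<open>1\<close> is impossible
  because every step moves.\<close>

lemma periodic_walk_trapped:
  assumes u: "\<And>y. \<bar>u y\<bar> = 1" and v: "\<And>x. \<bar>v x\<bar> = 1"
    and "0 < m" "walk u v p m = p"
  shows "trapped u v p"
proof -
  define n where "n = (LEAST n. 0 < n \<and> walk u v p n = p)"
  have n: "0 < n" "walk u v p n = p"
    using LeastI[of "\<lambda>n. 0 < n \<and> walk u v p n = p" m] assms unfolding n_def by auto
  have least: "walk u v p k \<noteq> p" if "0 < k" "k < n" for k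
    using not_less_Least[of k "\<lambda>n. 0 < n \<and> walk u v p n = p"] that unfolding n_def by auto
  have period: "walk u v p (t + n) = walk u v p t" for t
    by (simp add: funpow_add n)
  have return: "walk u v p s \<noteq> walk u v p t" if "s < t" "t < s + n" for s t
  proof
    assume eq: "walk u v p s = walk u v p t"
    obtain k where k: "s \<le> k * n"
      using n(1) by (metis mult.commute mult_le_mono1 nat_mult_1 Suc_leI One_nat_def)
    have mult: "walk u v p (k * n) = p" for k
      by (induction k) (simp_all add: funpow_add n)
    have "walk u v p (k * n - s + t) = walk u v p (k * n - s + s)"
      using eq by (simp only: funpow_add o_apply)
    also have "\<dots> = p" using k mult[of k] by simp
    also have "k * n - s + t = (t - s) + k * n" using that k by simp
    finally have "walk u v p (t - s) = p" by (simp add: funpow_add mult)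
    then show False using least[of "t - s"] that by auto
  qed
  show ?thesis
  proof (cases "3 \<le> n")
    case False
    have "walk u v p 1 \<noteq> p" using u[of "snd p"] by (auto simp: step_def prod_eq_iff)
    then have "n = 2" using False n by (cases "n = 1") auto
    with n show ?thesis by (simp add: trapped_def numeral_2_eq_2)
  next
    case True
    (* closed_lattice_curve_turns wants the curve to start at its leftmost lowest point. *)
    define S where "S = range (walk u v p)"
    have "walk u v p t \<in> walk u v p ` {..<n}" for t
    proof -
      have "walk u v p (t mod n + k * n) = walk u v p (t mod n)" for k
        by (induction k) (use period in \<open>simp_all add: add.assoc[symmetric] add.commute[of n]\<close>)
      from this[of "t div n"] show ?thesis using n by (auto intro!: image_eqI[of _ _ "t mod n"])
    qed
    then have "finite S" by (auto simp: S_def intro: finite_subset[of _ "walk u v p ` {..<n}"])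
    define b where "b = Min (snd ` S)"
    define a where "a = Min (fst ` {q \<in> S. snd q = b})"
    have "S \<noteq> {}" by (auto simp: S_def)
    have "b \<in> snd ` S" unfolding b_def using \<open>finite S\<close> \<open>S \<noteq> {}\<close> by (intro Min_in) auto
    then have "a \<in> fst ` {q \<in> S. snd q = b}"
      unfolding a_def using \<open>finite S\<close> by (intro Min_in) auto
    then obtain r where r: "walk u v p r = (a, b)" by (auto simp: S_def)
    have low: "b \<le> snd q" if "q \<in> S" for q
      using that \<open>finite S\<close> by (simp add: b_def)
    have left: "a \<le> fst q" if "q \<in> S" "snd q = b" for q
      using that \<open>finite S\<close> by (auto simp: a_def)
    define x where "x t = fst (walk u v p (r + t))" for t
    define y where "y t = snd (walk u v p (r + t))" for t
    have xy: "x (Suc t) = x t + u (y t)" "y (Suc t) = y t + v (x t)" for t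
      by (simp_all add: x_def y_def step_def)
    have per: "x (t + n) = x t" "y (t + n) = y t" for t
      using period[of "r + t"] by (simp_all add: x_def y_def add.assoc)
    have "(\<Sum>t<n. (x (Suc t) - x t) * (y (Suc (Suc t)) - y (Suc t))
              - (y (Suc t) - y t) * (x (Suc (Suc t)) - x (Suc t))) \<noteq> 0"
    proof (rule closed_lattice_curve_turns)
      show "(x s, y s) \<noteq> (x t, y t)" if "s < t" "t < s + n" for s t
        using return[of "r + s" "r + t"] that by (auto simp: x_def y_def prod_eq_iff)
      show "y 0 \<le> y t" for t using low[of "walk u v p (r + t)"] r by (simp add: y_def S_def)
      show "x 0 \<le> x t" if "y t = y 0" for t
        using left[of "walk u v p (r + t)"] that r by (simp add: x_def y_def S_def)
    qed (use True in \<open>simp_all add: xy u v per\<close>)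
    with sum_turns_closed_walk[of u v x y n, OF u v xy] per[of 0]
    show ?thesis by (simp add: xy)
  qed
qed

section \<open>Walks with finitely many trials\<close>

abbreviation columns :: "(int \<Rightarrow> int) \<Rightarrow> (int \<Rightarrow> int) \<Rightarrow> int \<times> int \<Rightarrow> nat \<Rightarrow> int set" where
  "columns u v p t \<equiv> (\<lambda>s. fst (walk u v p s)) ` {..t}"

abbreviation rows :: "(int \<Rightarrow> int) \<Rightarrow> (int \<Rightarrow> int) \<Rightarrow> int \<times> int \<Rightarrow> nat \<Rightarrow> int set" where
  "rows u v p t \<equiv> (\<lambda>s. snd (walk u v p s)) ` {..t}"

text \<open>A trial is a step after which only signs not yet seen decide whether the walk is now trapped. The walk
  arrives at \<open>(x', y')\<close> from \<open>(x, y)\<close>, and it goes straight back if and only if \<open>v x' = - v x\<close> and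
  \<open>u y' = - u y\<close>. In a trial at least one of the two lines \<open>x'\<close> and \<open>y'\<close> is visited for the first time,
  and a line that is visited again carries the sign required for a return.\<close>

definition trial :: "(int \<Rightarrow> int) \<Rightarrow> (int \<Rightarrow> int) \<Rightarrow> int \<times> int \<Rightarrow> nat \<Rightarrow> bool" where
  "trial u v p t \<longleftrightarrow>
    (let (x, y) = walk u v p t; (x', y') = walk u v p (Suc t) in
      (x' \<notin> columns u v p t \<or> y' \<notin> rows u v p t)
      \<and> (x' \<in> columns u v p t \<longrightarrow> v x' = - v x)
      \<and> (y' \<in> rows u v p t \<longrightarrow> u y' = - u y))"

lemma walk_add: "walk u v p (s + t) = walk u v (walk u v p s) t"
  by (simp add: funpow_add add.commute[of s])

lemma step_swap: "step v u (prod.swap p) = prod.swap (step u v p)"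
  by (simp add: step_def)

lemma walk_swap: "walk v u (prod.swap p) t = prod.swap (walk u v p t)"
  by (induction t) (simp_all add: step_swap)

lemma trial_swap: "trial v u (prod.swap p) t \<longleftrightarrow> trial u v p t"
  unfolding trial_def walk_swap by (auto simp: case_prod_beta Let_def)

lemma trapped_stays: "trapped u v p \<Longrightarrow> trapped u v (step u v p)"
  by (simp add: trapped_def)

lemma trapped_walk: "trapped u v p \<Longrightarrow> trapped u v (walk u v p t)"
  by (induction t) (simp_all add: trapped_stays)

lemma no_trial_if_trapped:
  assumes "trapped u v (walk u v p s)" "s < t"
  shows "\<not> trial u v p t"
proof -
  obtain r where r: "t = Suc (s + r)" using assms(2) less_iff_Suc_add by auto
  have "trapped u v (walk u v p (s + r))"
    using trapped_walk[OF assms(1)] by (simp add: walk_add)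
  then have "walk u v p (Suc t) = walk u v p (s + r)"
    by (simp add: trapped_def r)
  then have "fst (walk u v p (Suc t)) \<in> columns u v p t" "snd (walk u v p (Suc t)) \<in> rows u v p t"
    using r by (auto intro!: image_eqI[of _ _ "s + r"])
  then show ?thesis by (auto simp: trial_def case_prod_beta Let_def)
qed

lemma trapped_iff:
  "trapped u v p \<longleftrightarrow> v (fst (step u v p)) = - v (fst p) \<and> u (snd (step u v p)) = - u (snd p)"
  by (auto simp: trapped_def step_def prod_eq_iff)

lemma walk_cong:
  assumes "\<And>y. y \<in> rows u v p t \<Longrightarrow> u' y = u y" "\<And>x. x \<in> columns u v p t \<Longrightarrow> v' x = v x"
    and "s \<le> Suc t"
  shows "walk u' v' p s = walk u v p s"
  using \<open>s \<le> Suc t\<close>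
proof (induction s)
  case (Suc s)
  then have "fst (walk u v p s) \<in> columns u v p t" "snd (walk u v p s) \<in> rows u v p t" by auto
  with Suc assms(1,2) show ?case by (simp add: step_def[of _ _ "walk u v p s"])
qed simp

lemma trial_cong:
  assumes "\<And>y. y \<in> rows u v p t \<Longrightarrow> u' y = u y" "\<And>x. x \<in> columns u v p t \<Longrightarrow> v' x = v x"
  shows "trial u' v' p t = trial u v p t"
proof -
  have eq: "walk u' v' p s = walk u v p s" if "s \<le> Suc t" for s
    using walk_cong[of u v p t u' v' s] assms that by blast
  have "rows u' v' p t = rows u v p t" "columns u' v' p t = columns u v p t"
    using eq by auto
  moreover have "fst (walk u v p t) \<in> columns u v p t" "snd (walk u v p t) \<in> rows u v p t" by auto
  ultimately show ?thesis
    using assms eq[of t] eq[of "Suc t"] unfolding trial_def case_prod_beta Let_def by (simp del: funpow.simps)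
qed

text \<open>The visited columns form an interval, because a walk changes its column by one in every step. So a new
  column lies beyond all earlier ones, on the side to which the walk is moving.\<close>

lemma fresh_column_is_extreme:
  fixes x :: "nat \<Rightarrow> int"
  assumes dx: "\<And>t. \<bar>x (Suc t) - x t\<bar> = 1" and \<sigma>: "\<bar>\<sigma>\<bar> = 1"
    and fresh: "x t + \<sigma> \<notin> x ` {..t}" and "s \<le> t"
  shows "\<sigma> * x s \<le> \<sigma> * x t"
proof (rule ccontr)
  assume above: "\<not> \<sigma> * x s \<le> \<sigma> * x t"
  have "\<exists>i. s \<le> i \<and> i \<le> t \<and> - (\<sigma> * x i) = - (\<sigma> * x t + 1)"
  proof (rule nat_intermed_int_val)
    show "\<forall>i. s \<le> i \<and> i < t \<longrightarrow> \<bar>- (\<sigma> * x (Suc i)) - - (\<sigma> * x i)\<bar> \<le> 1"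
      using dx \<sigma> by (simp add: abs_minus_commute abs_mult flip: right_diff_distrib)
    show "- (\<sigma> * x s) \<le> - (\<sigma> * x t + 1)" using above by simp
  qed (use \<open>s \<le> t\<close> in auto)
  then obtain i where "i \<le> t" "x i = x t + \<sigma>"
    using \<sigma> by (auto simp: abs_one_cases)
  with fresh show False by (metis atMost_iff image_eqI)
qed

definition has_long_runs :: "(int \<Rightarrow> int) \<Rightarrow> bool" where
  "has_long_runs f \<longleftrightarrow>
    (\<forall>a \<sigma> m. \<bar>\<sigma>\<bar> = 1 \<longrightarrow> (\<exists>k. \<forall>i<m. f (a + \<sigma> * int (k + i)) = 1))"

text \<open>Suppose that a walk visits infinitely many columns, and consider a visit to a new column after the last
  trial. As this step is no trial, its row is an old one with the same sign as before, so the walk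
  moves on in the same horizontal direction, to another new column. Hence it runs through new columns
  forever, in a fixed direction and within finitely many rows. This is impossible, since a long run
  of columns with sign \<open>1\<close> carries it upwards by an arbitrary distance.\<close>

lemma finite_columns:
  assumes u: "\<And>y. \<bar>u y\<bar> = 1" and v: "\<And>x. \<bar>v x\<bar> = 1"
    and trials: "finite {t. trial u v p t}" and runs: "has_long_runs v"
  shows "finite (range (\<lambda>t. fst (walk u v p t)))"
proof (rule ccontr)
  define x where "x t = fst (walk u v p t)" for t
  define y where "y t = snd (walk u v p t)" for t
  have xy: "x (Suc t) = x t + u (y t)" "y (Suc t) = y t + v (x t)" for t
    by (simp_all add: x_def y_def step_def)
  assume "\<not> ?thesis"
  then have inf: "infinite (range x)" by (simp add: x_def[abs_def])
  obtain T where T: "\<And>t. T \<le> t \<Longrightarrow> \<not> trial u v p t"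
    using trials by (auto simp: finite_nat_set_iff_bounded_le) (meson not_less_eq_eq)
  obtain t where t: "T \<le> t" "x (Suc t) \<notin> x ` {..t}"
  proof (rule ccontr)
    assume "\<not> thesis"
    with that have old: "x (Suc t) \<in> x ` {..t}" if "T \<le> t" for t using that by blast
    have "x ` {..T + k} \<subseteq> x ` {..T}" for k
    proof (induction k)
      case (Suc k)
      then show ?case using old[of "T + k"] by (auto simp: atMost_Suc)
    qed simp
    then have "range x \<subseteq> x ` {..T}"
      by (metis (no_types, lifting) atMost_iff image_subset_iff le_add2 rangeE subsetI)
    with inf show False using finite_subset by blast
  qed
  (* From here on the walk runs through new columns in the direction \<sigma> and meets only rows that it
     has visited before. *)
  define \<sigma> where "\<sigma> = u (y t)"
  have \<sigma>: "\<bar>\<sigma>\<bar> = 1" by (simp add: \<sigma>_def u)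
  have extreme: "\<sigma> * x s \<le> \<sigma> * x t" if "s \<le> t" for s
    using fresh_column_is_extreme[of x \<sigma> t s] t(2) that u \<sigma> by (simp add: xy \<sigma>_def)
  have run: "x (t + k) = x t + \<sigma> * int k \<and> y (t + k) \<in> y ` {..t} \<and> u (y (t + k)) = \<sigma>" for k
  proof (induction k rule: less_induct)
    case (less k)
    show ?case
    proof (cases k)
      case 0
      then show ?thesis by (simp add: \<sigma>_def)
    next
      case (Suc j)
      have x: "x (t + k) = x t + \<sigma> * int k"
        using less[of j] by (simp add: Suc xy algebra_simps)
      have "x (t + k) \<noteq> x s" if "s \<le> t + j" for s
      proof (cases "s \<le> t")
        case True
        from extreme[OF True] show ?thesis using x \<sigma> Suc by (auto simp: abs_one_cases)
      next
        case False
        then obtain i where i: "s = t + i" by (metis nat_le_linear le_iff_add)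
        then show ?thesis using x \<sigma> Suc less[of i] that by auto
      qed
      then have "x (Suc (t + j)) \<notin> columns u v p (t + j)"
        by (auto simp: Suc x_def)
      with T[of "t + j"] t(1) have old: "y (t + k) \<in> rows u v p (t + j)" "u (y (t + k)) \<noteq> - u (y (t + j))"
        unfolding trial_def by (auto simp: case_prod_beta Let_def x_def y_def Suc)
      have "y s \<in> y ` {..t}" if "s \<le> t + j" for s
      proof (cases "s \<le> t")
        case False
        then obtain i where i: "s = t + i" by (metis nat_le_linear le_iff_add)
        then show ?thesis using less[of i] that Suc by auto
      qed auto
      then have "y (t + k) \<in> y ` {..t}" using old(1) by (auto simp: y_def)
      moreover have "u (y (t + k)) = \<sigma>"
        using old(2) less[of j] u[of "y (t + k)"] \<sigma> Suc by (auto simp: abs_one_cases)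
      ultimately show ?thesis using x by blast
    qed
  qed
  define b where "b = Max (y ` {..t})"
  define a where "a = Min (y ` {..t})"
  have ab: "a \<le> y (t + k)" "y (t + k) \<le> b" for k
    using run[of k] by (auto simp: a_def b_def)
  obtain k where k: "\<forall>i<nat (b - a + 1). v (x t + \<sigma> * int (k + i)) = 1"
    using runs \<sigma> unfolding has_long_runs_def by blast
  have "i \<le> nat (b - a + 1) \<Longrightarrow> y (t + (k + i)) = y (t + k) + int i" for i
  proof (induction i)
    case (Suc i)
    then show ?case using k run[of "k + i"] by (simp add: xy)
  qed simp
  from this[of "nat (b - a + 1)"] ab(1)[of k] ab(2)[of "k + nat (b - a + 1)"] show False by linarith
qed

text \<open>Rows are treated by exchanging the two coordinates. A walk confined to finitely many columns and rows
  is eventually periodic, hence trapped by \<open>periodic_walk_trapped\<close>.\<close>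

lemma eventually_trapped:
  assumes u: "\<And>y. \<bar>u y\<bar> = 1" and v: "\<And>x. \<bar>v x\<bar> = 1"
    and trials: "finite {t. trial u v p t}" and runs: "has_long_runs u" "has_long_runs v"
  shows "\<exists>t. trapped u v (walk u v p t)"
proof -
  have "finite (range (\<lambda>t. fst (walk u v p t)))"
    by (rule finite_columns) (fact u v trials runs)+
  moreover have "finite (range (\<lambda>t. fst (walk v u (prod.swap p) t)))"
    by (rule finite_columns[OF v u _ runs(1)]) (simp add: trial_swap trials)
  ultimately have "finite (range (\<lambda>t. fst (walk u v p t)) \<times> range (\<lambda>t. snd (walk u v p t)))"
    by (simp add: walk_swap)
  then have "finite (range (walk u v p))"
    by (rule finite_subset[rotated]) (intro image_subsetI, simp add: mem_Times_iff)
  then have "\<not> inj (walk u v p)"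
    using finite_imageD infinite_UNIV_nat by blast
  then obtain s t where "s \<noteq> t" "walk u v p s = walk u v p t"
    unfolding inj_def by blast
  then obtain s t where st: "s < t" "walk u v p s = walk u v p t"
    by (cases s t rule: linorder_cases) auto
  then have "walk u v (walk u v p s) (t - s) = walk u v p s" "0 < t - s"
    using walk_add[where s = s and t = "t - s" and u = u and v = v and p = p] by auto
  then have "trapped u v (walk u v p s)"
    using periodic_walk_trapped[of u v, OF u v] by blast
  then show ?thesis by blast
qed

section \<open>Sequences of fair signs\<close>

text \<open>A form of the first Borel-Cantelli lemma: the sum of the probabilities of disjoint events is at most
  one, so the probabilities of the dominated events are summable. It is applied to the
  trials of a walk, to runs of equal signs, and to the vertices that are led into a given trap.\<close>

lemma (in prob_space) AE_finite_dominated: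
  fixes A B :: "'i :: countable \<Rightarrow> 'a set"
  assumes A: "\<And>i. A i \<in> events" and B: "\<And>i. B i \<in> events" and disj: "disjoint_family B"
    and le: "\<And>i. prob (A i) \<le> c * prob (B i)"
  shows "AE x in M. finite {i. x \<in> A i}"
proof -
  define A' where "A' n = (if n \<in> range (to_nat :: 'i \<Rightarrow> nat) then A (from_nat n) else {})" for n
  define B' where "B' n = (if n \<in> range (to_nat :: 'i \<Rightarrow> nat) then B (from_nat n) else {})" for n
  have "disjoint_family B'"
    using disj by (auto simp: disjoint_family_on_def B'_def) blast
  moreover have "range B' \<subseteq> events" using B by (auto simp: B'_def)
  ultimately have "summable (\<lambda>n. prob (B' n))"
    using finite_measure_UNION sums_summable by blast
  then have "summable (\<lambda>n. c * prob (B' n))" by (rule summable_mult)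
  then have "summable (\<lambda>n. prob (A' n))"
    by (rule summable_comparison_test') (auto simp: A'_def B'_def le)
  then have "AE x in M. eventually (\<lambda>n. x \<in> space M - A' n) sequentially"
    by (intro borel_cantelli_AE1) (auto simp: A'_def A less_top[symmetric])
  then show ?thesis
  proof eventually_elim
    case (elim x)
    then obtain N where N: "\<And>n. N \<le> n \<Longrightarrow> x \<notin> A' n" by (auto simp: eventually_sequentially)
    have "to_nat i < N" if "x \<in> A i" for i
    proof (rule ccontr)
      assume "\<not> to_nat i < N"
      with N[of "to_nat i"] that show False by (simp add: A'_def)
    qed
    then have "to_nat ` {i. x \<in> A i} \<subseteq> {..<N}" by auto
    then have "finite (to_nat ` {i. x \<in> A i})" by (rule finite_subset) simp
    then show ?case by (rule finite_imageD) simp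
  qed
qed

abbreviation coin :: "int pmf" where
  "coin \<equiv> pmf_of_set {-1, 1}"

text \<open>The measure lives on all integer-valued families, so that its space is the whole type; a family takes
  other values than \<open>\<plusminus>1\<close> with probability zero.\<close>

definition coin_tosses :: "('i \<Rightarrow> int) measure" where
  "coin_tosses = PiM UNIV (\<lambda>_. measure_pmf coin)"

lemma prob_space_coin_tosses: "prob_space coin_tosses"
  unfolding coin_tosses_def by (intro prob_space_PiM) (rule measure_pmf.prob_space_axioms)

interpretation coin_tosses: prob_space coin_tosses
  by (rule prob_space_coin_tosses)

lemma space_coin_tosses [simp]: "space coin_tosses = UNIV"
  by (simp add: coin_tosses_def space_PiM)

lemma measurable_toss [measurable]: "(\<lambda>e. e i) \<in> coin_tosses \<rightarrow>\<^sub>M count_space UNIV"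
proof -
  have "(\<lambda>e. e i) \<in> coin_tosses \<rightarrow>\<^sub>M measure_pmf coin"
    unfolding coin_tosses_def by (rule measurable_component_singleton) simp
  then show ?thesis by simp
qed

lemma AE_toss_abs:
  "AE e in (coin_tosses :: ('i::countable \<Rightarrow> int) measure). \<forall>i. \<bar>e i\<bar> = 1"
proof -
  have "AE e in (coin_tosses :: ('i \<Rightarrow> int) measure). \<bar>e i\<bar> = 1" for i
    unfolding coin_tosses_def
    by (rule AE_PiM_component[where P = "\<lambda>z. \<bar>z\<bar> = 1"])
      (auto simp: measure_pmf.prob_space_axioms AE_measure_pmf_iff)
  then show ?thesis by (simp add: AE_all_countable)
qed

lemma emeasure_coin_mult:
  assumes "\<bar>s\<bar> = 1"
  shows "emeasure (measure_pmf coin) {z. s * z \<in> A} = emeasure (measure_pmf coin) A"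
proof -
  have "map_pmf ((*) s) coin = coin"
    using assms by (subst map_pmf_of_set_inj) (auto simp: abs_one_cases inj_on_def insert_commute)
  then have "emeasure (measure_pmf coin) A = emeasure (measure_pmf (map_pmf ((*) s) coin)) A" by simp
  also have "\<dots> = emeasure (measure_pmf coin) ((*) s -` A)" by (rule emeasure_map_pmf)
  finally show ?thesis by (simp add: vimage_def)
qed

lemma measurable_signed_reindex:
  "(\<lambda>e i. s i * e (\<pi> i)) \<in> coin_tosses \<rightarrow>\<^sub>M coin_tosses"
  by (subst (2) coin_tosses_def, rule measurable_PiM_single') auto

text \<open>This covers both invariances in use: sign flips and translations of the plane.\<close>

lemma distr_coin_tosses:
  assumes \<pi>: "inj \<pi>" and s: "\<And>i. \<bar>s i\<bar> = 1"
  shows "distr coin_tosses coin_tosses (\<lambda>e i. s i * e (\<pi> i)) = coin_tosses"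
proof -
  let ?T = "\<lambda>e i. s i * e (\<pi> i)"
  have [measurable]: "?T \<in> coin_tosses \<rightarrow>\<^sub>M coin_tosses"
    by (rule measurable_signed_reindex)
  have *: "emeasure (distr coin_tosses coin_tosses ?T) (prod_emb UNIV (\<lambda>_. measure_pmf coin) J (Pi\<^sub>E J A))
    = (\<Prod>i\<in>J. emeasure (measure_pmf coin) (A i))" if J: "finite J" for J A
  proof -
    have sets: "prod_emb UNIV (\<lambda>_. measure_pmf coin) J (Pi\<^sub>E J A) \<in> sets coin_tosses"
      unfolding coin_tosses_def using J by (intro sets_PiM_I) auto
    let ?A = "\<lambda>j. {z. s (inv \<pi> j) * z \<in> A (inv \<pi> j)}"
    have "?T -` prod_emb UNIV (\<lambda>_. measure_pmf coin) J (Pi\<^sub>E J A)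
      = prod_emb UNIV (\<lambda>_. measure_pmf coin) (\<pi> ` J) (Pi\<^sub>E (\<pi> ` J) ?A)"
      using \<pi> by (auto simp: prod_emb_def PiE_iff)
    then have "emeasure (distr coin_tosses coin_tosses ?T) (prod_emb UNIV (\<lambda>_. measure_pmf coin) J (Pi\<^sub>E J A))
      = emeasure coin_tosses (prod_emb UNIV (\<lambda>_. measure_pmf coin) (\<pi> ` J) (Pi\<^sub>E (\<pi> ` J) ?A))"
      using sets by (simp add: emeasure_distr)
    also have "\<dots> = (\<Prod>j\<in>\<pi> ` J. emeasure (measure_pmf coin) (?A j))"
      unfolding coin_tosses_def using J
      by (intro emeasure_PiM_emb) (auto simp: measure_pmf.prob_space_axioms)
    also have "\<dots> = (\<Prod>j\<in>\<pi> ` J. emeasure (measure_pmf coin) (A (inv \<pi> j)))"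
      by (simp add: emeasure_coin_mult s)
    also have "\<dots> = (\<Prod>i\<in>J. emeasure (measure_pmf coin) (A i))"
      using \<pi> by (subst prod.reindex) (auto intro: inj_on_subset)
    finally show ?thesis .
  qed
  show ?thesis
  proof (subst (3) coin_tosses_def, rule measure_eqI_PiM_infinite[where I = UNIV and M = "\<lambda>_. measure_pmf coin"])
    show "sets (distr coin_tosses coin_tosses ?T) = sets (Pi\<^sub>M UNIV (\<lambda>_. measure_pmf coin))"
      by (simp add: coin_tosses_def)
    show "finite_measure (distr coin_tosses coin_tosses ?T)"
      by (intro prob_space.finite_measure coin_tosses.prob_space_distr) simp
    show "emeasure (distr coin_tosses coin_tosses ?T) (prod_emb UNIV (\<lambda>_. measure_pmf coin) J (Pi\<^sub>E J A))
      = emeasure (Pi\<^sub>M UNIV (\<lambda>_. measure_pmf coin)) (prod_emb UNIV (\<lambda>_. measure_pmf coin) J (Pi\<^sub>E J A))"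
      if "finite J" for J A
      using that by (subst *) (auto intro!: emeasure_PiM_emb[symmetric] simp: measure_pmf.prob_space_axioms)
  qed simp
qed

lemma prob_vimage_signed_reindex:
  assumes "inj \<pi>" "\<And>i. \<bar>s i\<bar> = 1" "A \<in> sets coin_tosses"
  shows "coin_tosses.prob ((\<lambda>e i. s i * e (\<pi> i)) -` A) = coin_tosses.prob A"
  using measure_distr[OF measurable_signed_reindex assms(3), of s \<pi>] distr_coin_tosses[OF assms(1,2)]
  by simp

definition flip :: "'i set \<Rightarrow> ('i \<Rightarrow> int) \<Rightarrow> 'i \<Rightarrow> int" where
  "flip J e i = (if i \<in> J then - e i else e i)"

lemma flip_eq_signed: "flip J = (\<lambda>e i. (if i \<in> J then -1 else 1) * e (id i))"
  by (auto simp: flip_def fun_eq_iff)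

text \<open>Flipping the signs in a fixed set preserves the measure. If each point of \<open>A\<close> is moved
  into \<open>B\<close> by some flip within \<open>S\<close>, then \<open>A\<close> is covered by the preimages of \<open>B\<close> under the \<open>2 ^ card S\<close> possible flips. The
  set to be flipped may depend on the point, so this replaces conditioning on the part of the
  environment that has been explored.\<close>

lemma prob_le_if_flip:
  fixes A B :: "('i::countable \<Rightarrow> int) set"
  assumes A: "A \<in> sets coin_tosses" and B: "B \<in> sets coin_tosses" and S: "finite S"
    and flip: "\<And>e. e \<in> A \<Longrightarrow> (\<And>i. \<bar>e i\<bar> = 1) \<Longrightarrow> \<exists>J\<subseteq>S. flip J e \<in> B"
  shows "coin_tosses.prob A \<le> 2 ^ card S * coin_tosses.prob B"
proof -
  have sets: "flip J -` B \<in> sets coin_tosses" for J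
    using measurable_sets[OF measurable_signed_reindex B] by (simp add: flip_eq_signed)
  have "coin_tosses.prob A \<le> coin_tosses.prob (\<Union>J\<in>Pow S. flip J -` B)"
  proof (rule coin_tosses.finite_measure_mono_AE)
    show "AE e in coin_tosses. e \<in> A \<longrightarrow> e \<in> (\<Union>J\<in>Pow S. flip J -` B)"
      using AE_toss_abs by eventually_elim (use flip in fastforce)
  qed (use sets S in auto)
  also have "\<dots> \<le> (\<Sum>J\<in>Pow S. coin_tosses.prob (flip J -` B))"
    using S sets by (intro coin_tosses.finite_measure_subadditive_finite) auto
  also have "\<dots> = (\<Sum>J\<in>Pow S. coin_tosses.prob B)"
    unfolding flip_eq_signed by (intro sum.cong refl prob_vimage_signed_reindex B) auto
  also have "\<dots> = 2 ^ card S * coin_tosses.prob B"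
    using S by (simp add: card_Pow)
  finally show ?thesis .
qed

section \<open>Almost every walk is trapped\<close>

lemma measurable_count_space_pair:
  fixes f :: "'a \<Rightarrow> 'b::countable" and g :: "'a \<Rightarrow> 'c::countable"
  assumes f: "f \<in> M \<rightarrow>\<^sub>M count_space UNIV" and g: "g \<in> M \<rightarrow>\<^sub>M count_space UNIV"
  shows "(\<lambda>x. h (f x) (g x)) \<in> M \<rightarrow>\<^sub>M count_space UNIV"
  by (rule measurable_compose_countable[OF _ f], rule measurable_compose[OF g]) simp

text \<open>An environment carries the signs of the rows at \<open>Inl\<close> and those of the columns at \<open>Inr\<close>.\<close>

abbreviation env_walk :: "(int + int \<Rightarrow> int) \<Rightarrow> int \<times> int \<Rightarrow> nat \<Rightarrow> int \<times> int" where
  "env_walk e \<equiv> walk (\<lambda>y. e (Inl y)) (\<lambda>x. e (Inr x))"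

lemma measurable_env_walk [measurable]:
  "(\<lambda>e. env_walk e p t) \<in> coin_tosses \<rightarrow>\<^sub>M count_space UNIV"
proof (induction t)
  case (Suc t)
  have "(\<lambda>e. step (\<lambda>y. e (Inl y)) (\<lambda>x. e (Inr x)) q) \<in> coin_tosses \<rightarrow>\<^sub>M count_space UNIV" for q
    unfolding step_def
    by (rule measurable_count_space_pair[OF measurable_toss measurable_toss])
  from measurable_compose_countable[OF this Suc] show ?case by simp
qed simp

text \<open>The walk takes countably many values, so its positions may be treated as constants in questions of
  measurability.\<close>

lemma pred_env_walk:
  assumes "\<And>q. Measurable.pred coin_tosses (\<lambda>e. R q e)"
  shows "Measurable.pred coin_tosses (\<lambda>e. R (env_walk e p t) e)"
  by (rule measurable_compose_countable[OF assms measurable_env_walk])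

lemma pred_trapped [measurable]:
  "Measurable.pred coin_tosses (\<lambda>e. trapped (\<lambda>y. e (Inl y)) (\<lambda>x. e (Inr x)) p)"
proof -
  have "Measurable.pred coin_tosses (\<lambda>e. env_walk e p 2 = p)"
    by (rule measurable_compose[OF measurable_env_walk]) simp
  then show ?thesis by (simp add: trapped_def numeral_2_eq_2)
qed

lemma pred_trial [measurable]:
  "Measurable.pred coin_tosses (\<lambda>e. trial (\<lambda>y. e (Inl y)) (\<lambda>x. e (Inr x)) p t)"
proof -
  have visited: "Measurable.pred coin_tosses (\<lambda>e. x \<in> columns (\<lambda>y. e (Inl y)) (\<lambda>x. e (Inr x)) p t)"
    "Measurable.pred coin_tosses (\<lambda>e. y \<in> rows (\<lambda>y. e (Inl y)) (\<lambda>x. e (Inr x)) p t)" for x y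
  proof -
    have [measurable]: "Measurable.pred coin_tosses (\<lambda>e. x = fst (env_walk e p s))"
      "Measurable.pred coin_tosses (\<lambda>e. y = snd (env_walk e p s))" for s
      by (rule measurable_compose[OF measurable_env_walk], simp)+
    show "Measurable.pred coin_tosses (\<lambda>e. x \<in> columns (\<lambda>y. e (Inl y)) (\<lambda>x. e (Inr x)) p t)"
      "Measurable.pred coin_tosses (\<lambda>e. y \<in> rows (\<lambda>y. e (Inl y)) (\<lambda>x. e (Inr x)) p t)"
      unfolding image_iff by measurable
  qed
  have opposite: "Measurable.pred coin_tosses (\<lambda>e. e i = - e j)" for i j :: "int + int"
    by (rule measurable_count_space_pair[OF measurable_toss measurable_toss])
  define R where "R q q' e \<longleftrightarrow>
      (fst q' \<notin> columns (\<lambda>y. e (Inl y)) (\<lambda>x. e (Inr x)) p t \<or> snd q' \<notin> rows (\<lambda>y. e (Inl y)) (\<lambda>x. e (Inr x)) p t)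
      \<and> (fst q' \<in> columns (\<lambda>y. e (Inl y)) (\<lambda>x. e (Inr x)) p t \<longrightarrow> e (Inr (fst q')) = - e (Inr (fst q)))
      \<and> (snd q' \<in> rows (\<lambda>y. e (Inl y)) (\<lambda>x. e (Inr x)) p t \<longrightarrow> e (Inl (snd q')) = - e (Inl (snd q)))"
    for q q' :: "int \<times> int" and e :: "int + int \<Rightarrow> int"
  have R: "Measurable.pred coin_tosses (R q q')" for q q'
    unfolding R_def[abs_def] by (intro pred_intros_logic visited opposite)
  have "Measurable.pred coin_tosses (\<lambda>e. R q (env_walk e p (Suc t)) e)" for q
    by (rule pred_env_walk[of "R q"]) (rule R)
  then have "Measurable.pred coin_tosses (\<lambda>e. R (env_walk e p t) (env_walk e p (Suc t)) e)"
    by (rule pred_env_walk[of "\<lambda>q e. R q (env_walk e p (Suc t)) e"])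
  then show ?thesis
    by (simp only: R_def trial_def case_prod_beta Let_def)
qed

text \<open>A trial is indexed by its time together with the position reached. Once the position is fixed, the
  two signs that decide about a return belong to fixed coordinates, which can be flipped.\<close>

definition trial_at :: "int \<times> int \<Rightarrow> nat \<times> int \<times> int \<Rightarrow> (int + int \<Rightarrow> int) set" where
  "trial_at p i = {e. trial (\<lambda>y. e (Inl y)) (\<lambda>x. e (Inr x)) p (fst i) \<and> env_walk e p (Suc (fst i)) = snd i}"

definition success_at :: "int \<times> int \<Rightarrow> nat \<times> int \<times> int \<Rightarrow> (int + int \<Rightarrow> int) set" where
  "success_at p i = {e \<in> trial_at p i. trapped (\<lambda>y. e (Inl y)) (\<lambda>x. e (Inr x)) (env_walk e p (fst i))}"

lemma sets_trial_at: "trial_at p i \<in> sets coin_tosses"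
proof -
  have [measurable]: "Measurable.pred coin_tosses (\<lambda>e. env_walk e p (Suc (fst i)) = snd i)"
    by (rule measurable_compose[OF measurable_env_walk]) simp
  have "{e \<in> space coin_tosses. trial (\<lambda>y. e (Inl y)) (\<lambda>x. e (Inr x)) p (fst i)
      \<and> env_walk e p (Suc (fst i)) = snd i} \<in> sets coin_tosses"
    by measurable
  then show ?thesis by (simp add: trial_at_def)
qed

lemma pred_trapped_env_walk [measurable]:
  "Measurable.pred coin_tosses (\<lambda>e. trapped (\<lambda>y. e (Inl y)) (\<lambda>x. e (Inr x)) (env_walk e p t))"
  by (rule pred_env_walk) measurable

lemma sets_success_at: "success_at p i \<in> sets coin_tosses"
proof -
  have "{e \<in> space coin_tosses. e \<in> trial_at p i \<and> trapped (\<lambda>y. e (Inl y)) (\<lambda>x. e (Inr x)) (env_walk e p (fst i))}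
     \<in> sets coin_tosses"
    using sets_trial_at[of p i, measurable] by measurable
  then show ?thesis by (simp add: success_at_def)
qed

text \<open>After a successful trial the walk alternates between two positions, visits no new line, and so has
  no further trial.\<close>

lemma disjoint_success_at: "disjoint_family (success_at p)"
proof -
  have "i = j" if "e \<in> success_at p i" "e \<in> success_at p j" for e i j
  proof -
    have "\<not> fst i < fst j" "\<not> fst j < fst i"
      using that no_trial_if_trapped unfolding success_at_def trial_at_def by blast+
    then have "fst i = fst j" by simp
    with that show ?thesis by (auto simp: success_at_def trial_at_def prod_eq_iff)
  qed
  then show ?thesis by (auto simp: disjoint_family_on_def)
qed

text \<open>A trial succeeds with conditional probability at least \<open>1/4\<close>: flip the wrong ones among the two deciding
  signs. They belong to lines visited for the first time, so that flipping them changes neither the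
  walk up to this time nor the fact that the step is a trial.\<close>

lemma prob_trial_at_le: "coin_tosses.prob (trial_at p i) \<le> 4 * coin_tosses.prob (success_at p i)"
proof -
  obtain t a b where i: "i = (t, a, b)" by (metis prod.exhaust)
  let ?S = "{Inl b, Inr a} :: (int + int) set"
  have "coin_tosses.prob (trial_at p i) \<le> 2 ^ card ?S * coin_tosses.prob (success_at p i)"
  proof (rule prob_le_if_flip)
    fix e :: "int + int \<Rightarrow> int"
    assume e: "e \<in> trial_at p i" and one: "\<And>i. \<bar>e i\<bar> = 1"
    define u where "u y = e (Inl y)" for y
    define v where "v x = e (Inr x)" for x
    obtain x y where xy: "walk u v p t = (x, y)" by (metis prod.exhaust)
    have tr: "trial u v p t" and next_pos: "walk u v p (Suc t) = (a, b)"
      using e by (simp_all add: trial_at_def i u_def[abs_def] v_def[abs_def])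
    define J where "J = {Inr x' | x'. x' = a \<and> v a \<noteq> - v x} \<union> {Inl y' | y'. y' = b \<and> u b \<noteq> - u y}"
    define e' where "e' = flip J e"
    define u' where "u' y = e' (Inl y)" for y
    define v' where "v' x = e' (Inr x)" for x
    have J_fresh: "Inr z \<notin> J" if "z \<in> columns u v p t" for z
      using tr next_pos xy that by (auto simp: J_def trial_def)
    have J_fresh': "Inl z \<notin> J" if "z \<in> rows u v p t" for z
      using tr next_pos xy that by (auto simp: J_def trial_def)
    have eq: "u' z = u z" if "z \<in> rows u v p t" for z
      using J_fresh'[OF that] by (simp add: u'_def u_def e'_def flip_def)
    have eq': "v' z = v z" if "z \<in> columns u v p t" for z
      using J_fresh[OF that] by (simp add: v'_def v_def e'_def flip_def)
    have walk: "walk u' v' p s = walk u v p s" if "s \<le> Suc t" for s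
      using walk_cong[of u v p t u' v' s] eq eq' that by blast
    have "trial u' v' p t" using trial_cong[of u v p t u' v'] eq eq' tr by blast
    moreover have "trapped u' v' (walk u' v' p t)"
    proof -
      have "x \<in> columns u v p t" "y \<in> rows u v p t" using xy by (auto intro!: image_eqI[of _ _ t])
      then have "v' x = v x" "u' y = u y" using eq eq' by auto
      moreover have "v' a = - v x"
        using one[of "Inr a"] one[of "Inr x"]
        unfolding v'_def v_def e'_def flip_def J_def abs_one_cases by auto
      moreover have "u' b = - u y"
        using one[of "Inl b"] one[of "Inl y"]
        unfolding u'_def u_def e'_def flip_def J_def abs_one_cases by auto
      moreover have "step u' v' (x, y) = (a, b)"
        using walk[of t] walk[of "Suc t"] xy next_pos by simp
      moreover have "walk u' v' p t = (x, y)" using walk[of t] xy by simp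
      ultimately show ?thesis by (simp add: trapped_iff)
    qed
    moreover have "walk u' v' p (Suc t) = (a, b)" using walk[of "Suc t"] next_pos by simp
    moreover have "flip J e \<in> success_at p i \<longleftrightarrow>
      trial u' v' p t \<and> walk u' v' p (Suc t) = (a, b) \<and> trapped u' v' (walk u' v' p t)"
      unfolding success_at_def trial_at_def i u'_def[abs_def] v'_def[abs_def] e'_def by simp
    ultimately have "flip J e \<in> success_at p i" by blast
    moreover have "J \<subseteq> ?S" by (auto simp: J_def)
    ultimately show "\<exists>J\<subseteq>?S. flip J e \<in> success_at p i" by blast
  qed (simp_all add: sets_trial_at sets_success_at)
  then show ?thesis by simp
qed

lemma AE_finite_trials:
  "AE e in coin_tosses. finite {t. trial (\<lambda>y. e (Inl y)) (\<lambda>x. e (Inr x)) p t}"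
proof -
  have "AE e in coin_tosses. finite {i. e \<in> trial_at p i}"
    by (rule coin_tosses.AE_finite_dominated[OF sets_trial_at sets_success_at disjoint_success_at prob_trial_at_le])
  then show ?thesis
  proof eventually_elim
    case (elim e)
    have "{t. trial (\<lambda>y. e (Inl y)) (\<lambda>x. e (Inr x)) p t} \<subseteq> fst ` {i. e \<in> trial_at p i}"
    proof
      fix t
      assume "t \<in> {t. trial (\<lambda>y. e (Inl y)) (\<lambda>x. e (Inr x)) p t}"
      then have "e \<in> trial_at p (t, env_walk e p (Suc t))" by (simp add: trial_at_def)
      then show "t \<in> fst ` {i. e \<in> trial_at p i}" by (intro image_eqI[of _ _ "(t, env_walk e p (Suc t))"]) auto
    qed
    with elim show ?case by (meson finite_imageI finite_subset)
  qed
qed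

text \<open>Cut the sequence into blocks of length \<open>m\<close>. Flipping signs in block \<open>j\<close> turns the event that none of the
  blocks up to \<open>j\<close> is constantly \<open>1\<close> into the event that \<open>j\<close> is the first such block, and the latter events
  are disjoint.\<close>

lemma AE_run:
  fixes c :: "nat \<Rightarrow> 'i::countable"
  assumes c: "inj c"
  shows "AE e in coin_tosses. \<exists>k. \<forall>i<m. e (c (k + i)) = 1"
proof -
  define good where "good e j \<longleftrightarrow> (\<forall>i<m. e (c (j * m + i)) = 1)" for e :: "'i \<Rightarrow> int" and j
  define A where "A j = {e. \<forall>k\<le>j. \<not> good e k}" for j
  define B where "B j = {e. good e j \<and> (\<forall>k<j. \<not> good e k)}" for j
  have [measurable]: "Measurable.pred coin_tosses (\<lambda>e. good e j)" for j
  proof -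
    have [measurable]: "Measurable.pred coin_tosses (\<lambda>e. e i = 1)" for i :: 'i
      by (rule measurable_compose[OF measurable_toss]) simp
    show ?thesis unfolding good_def by measurable
  qed
  have "{e \<in> space coin_tosses. \<forall>k\<le>j. \<not> good e k} \<in> sets coin_tosses"
    "{e \<in> space coin_tosses. good e j \<and> (\<forall>k<j. \<not> good e k)} \<in> sets coin_tosses" for j
    by measurable
  then have sets: "A j \<in> sets coin_tosses" "B j \<in> sets coin_tosses" for j
    by (simp_all add: A_def B_def)
  have "disjoint_family B"
    unfolding disjoint_family_on_def
  proof (intro ballI impI)
    fix i j :: nat
    assume "i \<noteq> j"
    then show "B i \<inter> B j = {}" by (cases i j rule: linorder_cases) (auto simp: B_def)
  qed
  moreover have "coin_tosses.prob (A j) \<le> 2 ^ m * coin_tosses.prob (B j)" for j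
  proof -
    let ?S = "(\<lambda>i. c (j * m + i)) ` {..<m}"
    have "coin_tosses.prob (A j) \<le> 2 ^ card ?S * coin_tosses.prob (B j)"
    proof (rule prob_le_if_flip)
      fix e :: "'i \<Rightarrow> int"
      assume e: "e \<in> A j" and one: "\<And>i. \<bar>e i\<bar> = 1"
      define J where "J = {i \<in> ?S. e i = -1}"
      have "flip J e (c (j * m + i)) = 1" if "i < m" for i
        using one[of "c (j * m + i)"] that by (auto simp: flip_def J_def abs_one_cases)
      then have "good (flip J e) j" by (simp add: good_def)
      moreover have "good (flip J e) k \<longleftrightarrow> good e k" if "k < j" for k
      proof -
        have "c (k * m + i) \<noteq> c (j * m + i')" if "i < m" for i i'
        proof
          assume "c (k * m + i) = c (j * m + i')"
          then have "k * m + i = j * m + i'" using c by (simp add: inj_eq)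
          moreover have "Suc k * m \<le> j * m" using \<open>k < j\<close> by (intro mult_le_mono1) simp
          ultimately show False using \<open>i < m\<close> by simp
        qed
        then have "c (k * m + i) \<notin> J" if "i < m" for i
          using that by (auto simp: J_def)
        then show ?thesis by (simp add: good_def flip_def)
      qed
      ultimately have "flip J e \<in> B j" using e by (auto simp: A_def B_def)
      moreover have "J \<subseteq> ?S" by (auto simp: J_def)
      ultimately show "\<exists>J\<subseteq>?S. flip J e \<in> B j" by blast
    qed (simp_all add: sets)
    also have "card ?S = m"
    proof -
      have "inj_on (\<lambda>i. c (j * m + i)) {..<m}"
      proof (rule inj_onI)
        fix i i'
        assume "c (j * m + i) = c (j * m + i')"
        then have "j * m + i = j * m + i'" by (rule injD[OF c])
        then show "i = i'" by simp
      qed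
      then show ?thesis by (simp add: card_image)
    qed
    finally show ?thesis .
  qed
  ultimately have "AE e in coin_tosses. finite {j. e \<in> A j}"
    by (intro coin_tosses.AE_finite_dominated[of A B]) (simp_all add: sets)
  then show ?thesis
  proof eventually_elim
    case (elim e)
    then have "{j. e \<in> A j} \<noteq> UNIV" by auto
    then obtain k where "good e k" by (auto simp: A_def)
    then show ?case by (auto simp: good_def)
  qed
qed

lemma inj_arithmetic_progression:
  assumes "inj c" "\<sigma> \<noteq> 0"
  shows "inj (\<lambda>n. c (a + \<sigma> * int n))"
proof (rule injI)
  fix m n
  assume "c (a + \<sigma> * int m) = c (a + \<sigma> * int n)"
  then have "a + \<sigma> * int m = a + \<sigma> * int n" by (rule injD[OF assms(1)])
  then show "m = n" using assms(2) by simp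
qed

lemma AE_run_in_direction:
  fixes c :: "int \<Rightarrow> 'i::countable"
  assumes "inj c"
  shows "AE e in coin_tosses. \<bar>\<sigma>\<bar> = 1 \<longrightarrow> (\<exists>k. \<forall>i<m. e (c (a + \<sigma> * int (k + i))) = 1)"
proof (cases "\<sigma> = 0")
  case False
  from AE_run[OF inj_arithmetic_progression[OF assms False], of m a]
  show ?thesis by eventually_elim (rule impI)
qed simp

lemma AE_has_long_runs:
  fixes c :: "int \<Rightarrow> 'i::countable"
  assumes c: "inj c"
  shows "AE e in coin_tosses. has_long_runs (\<lambda>x. e (c x))"
  unfolding has_long_runs_def
  by (intro AE_all_countable[THEN iffD2, rule_format] AE_run_in_direction c)

lemma AE_eventually_trapped:
  "AE e in coin_tosses. \<forall>p. \<exists>t. trapped (\<lambda>y. e (Inl y)) (\<lambda>x. e (Inr x)) (env_walk e p t)"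
  unfolding AE_all_countable
proof
  fix p
  have "AE e in coin_tosses. has_long_runs (\<lambda>y. e (Inl y :: int + int))"
    "AE e in coin_tosses. has_long_runs (\<lambda>x. e (Inr x :: int + int))"
    by (rule AE_has_long_runs, rule inj_Inl, rule AE_has_long_runs, rule inj_Inr)
  then show "AE e in coin_tosses. \<exists>t. trapped (\<lambda>y. e (Inl y)) (\<lambda>x. e (Inr x)) (env_walk e p t)"
    using AE_finite_trials[of p] AE_toss_abs
  proof eventually_elim
    case (elim e)
    show ?case by (rule eventually_trapped) (use elim in simp_all)
  qed
qed

section \<open>Finitely many walks reach a given trap\<close>

definition first_trapped :: "(int \<Rightarrow> int) \<Rightarrow> (int \<Rightarrow> int) \<Rightarrow> int \<times> int \<Rightarrow> int \<times> int \<Rightarrow> bool" where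
  "first_trapped u v p q \<longleftrightarrow>
    (\<exists>n. walk u v p n = q \<and> trapped u v q \<and> (\<forall>k<n. \<not> trapped u v (walk u v p k)))"

lemma first_trapped_unique:
  assumes "first_trapped u v p q" "first_trapped u v p q'"
  shows "q = q'"
proof -
  obtain m n where "walk u v p m = q" "trapped u v q" "\<forall>k<m. \<not> trapped u v (walk u v p k)"
    "walk u v p n = q'" "trapped u v q'" "\<forall>k<n. \<not> trapped u v (walk u v p k)"
    using assms unfolding first_trapped_def by blast
  then show ?thesis by (cases m n rule: linorder_cases) auto
qed

lemma ex_first_trapped:
  assumes "trapped u v (walk u v p n)"
  shows "\<exists>q. first_trapped u v p q"
proof -
  define m where "m = (LEAST n. trapped u v (walk u v p n))"
  have "trapped u v (walk u v p m)" unfolding m_def using assms by (rule LeastI)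
  moreover have "\<not> trapped u v (walk u v p k)" if "k < m" for k
    using that not_less_Least unfolding m_def by blast
  ultimately show ?thesis unfolding first_trapped_def by blast
qed

lemma step_shift:
  "step (\<lambda>y. u (y + b)) (\<lambda>x. v (x + a)) p = step u v (p + (a, b)) - (a, b)"
  by (simp add: step_def prod_eq_iff)

lemma walk_shift:
  "walk (\<lambda>y. u (y + b)) (\<lambda>x. v (x + a)) p t = walk u v (p + (a, b)) t - (a, b)"
  by (induction t) (simp_all add: step_shift)

lemma trapped_shift:
  "trapped (\<lambda>y. u (y + b)) (\<lambda>x. v (x + a)) p \<longleftrightarrow> trapped u v (p + (a, b))"
  unfolding trapped_def step_shift by (auto simp: algebra_simps)

lemma first_trapped_shift:
  "first_trapped (\<lambda>y. u (y + b)) (\<lambda>x. v (x + a)) p q \<longleftrightarrow> first_trapped u v (p + (a, b)) (q + (a, b))"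
  unfolding first_trapped_def trapped_shift walk_shift by (auto simp: algebra_simps)

abbreviation env_first_trapped :: "(int + int \<Rightarrow> int) \<Rightarrow> int \<times> int \<Rightarrow> int \<times> int \<Rightarrow> bool" where
  "env_first_trapped e \<equiv> first_trapped (\<lambda>y. e (Inl y)) (\<lambda>x. e (Inr x))"

lemma sets_first_trapped: "{e. env_first_trapped e p q} \<in> sets coin_tosses"
proof -
  have [measurable]: "Measurable.pred coin_tosses (\<lambda>e. env_walk e p n = q)" for n
    by (rule measurable_compose[OF measurable_env_walk]) simp
  have "{e \<in> space coin_tosses. env_first_trapped e p q} \<in> sets coin_tosses"
    unfolding first_trapped_def by measurable
  then show ?thesis by simp
qed

text \<open>The law of the environment is invariant under translations of the plane.\<close>

lemma prob_first_trapped_shift: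
  "coin_tosses.prob {e. env_first_trapped e p q} = coin_tosses.prob {e. env_first_trapped e 0 (q - p)}"
proof -
  obtain a b where p: "p = (a, b)" by (metis prod.exhaust)
  define \<pi> :: "int + int \<Rightarrow> int + int" where "\<pi> = map_sum (\<lambda>y. y + b) (\<lambda>x. x + a)"
  have "inj \<pi>" by (auto simp: \<pi>_def inj_def map_sum_def split: sum.splits)
  from prob_vimage_signed_reindex[OF this _ sets_first_trapped, of "\<lambda>_. 1" 0 "q - p"]
  have "coin_tosses.prob {e. env_first_trapped e 0 (q - p)}
    = coin_tosses.prob {e. env_first_trapped (\<lambda>i. e (\<pi> i)) 0 (q - p)}"
    by (simp add: vimage_def)
  also have "{e. env_first_trapped (\<lambda>i. e (\<pi> i)) 0 (q - p)} = {e. env_first_trapped e p q}"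
    using first_trapped_shift[of "\<lambda>y. e (Inl y)" b "\<lambda>x. e (Inr x)" a 0 "q - p" for e]
    by (simp add: \<pi>_def p)
  finally show ?thesis ..
qed

text \<open>Mass transport: let every vertex send a unit of mass to its first trapped vertex. By translation
  invariance the expected mass received by \<open>q\<close> is that sent out by the origin, which is at most one
  because the first trapped vertex is unique. So \<open>q\<close> receives mass from finitely many vertices almost
  surely.\<close>

lemma AE_finite_first_trapped:
  "AE e in coin_tosses. \<forall>q. finite {p. env_first_trapped e p q}"
proof (rule AE_all_countable[THEN iffD2, rule_format])
  fix q
  have disj: "disjoint_family (\<lambda>p. {e. env_first_trapped e 0 (q - p)})"
    unfolding disjoint_family_on_def
  proof (intro ballI impI)
    fix p p'
    assume "p \<noteq> (p' :: int \<times> int)"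
    then have "q - p \<noteq> q - p'" by simp
    then show "{e. env_first_trapped e 0 (q - p)} \<inter> {e. env_first_trapped e 0 (q - p')} = {}"
      using first_trapped_unique by blast
  qed
  have "AE e in coin_tosses. finite {p. e \<in> {e. env_first_trapped e p q}}"
    by (rule coin_tosses.AE_finite_dominated[OF sets_first_trapped sets_first_trapped disj, where c = 1])
      (simp add: prob_first_trapped_shift[of _ q])
  then show "AE e in coin_tosses. finite {p. env_first_trapped e p q}" by simp
qed

section \<open>Components of the graph\<close>

text \<open>A component is a maximal connected subgraph, so an arc leaving one of its vertices may be added
  without destroying connectedness and therefore belongs to it.\<close>

lemma component_contains_outgoing_arc:
  assumes H: "H \<in> digraph_components G" and p: "p \<in> verts H" and pq: "(p, q) \<in> parcs G"
  shows "q \<in> verts H \<and> (p, q) \<in> arcs H"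
proof -
  have sub: "subgraph H (with_proj G)" and conn: "Digraph_Component.connected H"
    and max: "\<And>H'. subgraph H H' \<Longrightarrow> subgraph H' (with_proj G) \<Longrightarrow>
      Digraph_Component.connected H' \<Longrightarrow> H' = H"
    using H by (auto simp: digraph_components_def pre_digraph.max_subgraph_def)
  have wfG: "wf_digraph (with_proj G)" and wfH: "wf_digraph H" and comp: "tail H = fst" "head H = snd"
    and le: "verts H \<subseteq> pverts G" "arcs H \<subseteq> parcs G"
    using sub by (auto simp: subgraph_def compatible_def)
  have q: "q \<in> pverts G" using wf_digraph.head_in_verts[OF wfG, of "(p, q)"] pq by simp
  define H' where "H' = H\<lparr>verts := insert q (verts H), arcs := insert (p, q) (arcs H)\<rparr>"
  have H'_simps: "verts H' = insert q (verts H)" "arcs H' = insert (p, q) (arcs H)"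
    "tail H' = fst" "head H' = snd"
    by (simp_all add: H'_def comp)
  have wfH': "wf_digraph H'"
    using wfH p by (auto simp: wf_digraph_def H'_simps comp)
  have sub1: "subgraph H H'"
    using wfH wfH' by (auto simp: subgraph_def compatible_def H'_simps comp)
  have sub2: "subgraph H' (with_proj G)"
    using wfH' wfG le p q pq by (auto simp: subgraph_def compatible_def H'_simps)
  define R where "R = rtrancl_on (verts H') (parcs (mk_symmetric H'))"
  have arcs': "parcs (mk_symmetric H') = parcs (mk_symmetric H) \<union> {(p, q), (q, p)}"
    by (auto simp: parcs_mk_symmetric H'_simps comp)
  have old: "(a, b) \<in> R" if "a \<in> verts H" "b \<in> verts H" for a b
  proof -
    have "(a, b) \<in> rtrancl_on (verts H) (parcs (mk_symmetric H))"
      using conn that by (auto simp: Digraph_Component.connected_def strongly_connected_def reachable_def)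
    then show ?thesis
      unfolding R_def by (rule rtrancl_on_mono[rotated 2]) (auto simp: arcs' H'_simps)
  qed
  have pq': "(p, q) \<in> R" "(q, p) \<in> R" "(q, q) \<in> R"
    using p by (auto simp: R_def arcs' H'_simps intro: rtrancl_on_into_rtrancl_on)
  have "(a, b) \<in> R" if "a \<in> verts H'" "b \<in> verts H'" for a b
  proof -
    have "(a, p) \<in> R" "(p, b) \<in> R" using that old p pq' by (auto simp: H'_simps)
    then show ?thesis unfolding R_def by (rule rtrancl_on_trans)
  qed
  then have "Digraph_Component.connected H'"
    by (auto simp: Digraph_Component.connected_def strongly_connected_def reachable_def R_def H'_simps)
  then have "H' = H" using max sub1 sub2 by blast
  then show ?thesis using H'_simps(1,2) by auto
qed

lemma component_subset_closed:
  assumes H: "H \<in> digraph_components G" and p: "p \<in> verts H" "p \<in> S"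
    and closed: "\<And>a b. (a, b) \<in> parcs G \<Longrightarrow> a \<in> S \<longleftrightarrow> b \<in> S"
  shows "verts H \<subseteq> S"
proof
  fix q
  assume "q \<in> verts H"
  have sub: "subgraph H (with_proj G)" and conn: "Digraph_Component.connected H"
    using H by (auto simp: digraph_components_def pre_digraph.max_subgraph_def)
  have "(p, q) \<in> rtrancl_on (verts H) (parcs (mk_symmetric H))"
    using conn p \<open>q \<in> verts H\<close>
    by (auto simp: Digraph_Component.connected_def strongly_connected_def reachable_def)
  then show "q \<in> S"
  proof (induction rule: rtrancl_on_induct)
    case base
    show ?case by (rule p(2))
  next
    case (step a b)
    then show ?case
      using sub closed by (auto simp: parcs_mk_symmetric subgraph_def compatible_def)
  qed
qed

definition basin :: "(int \<Rightarrow> int) \<Rightarrow> (int \<Rightarrow> int) \<Rightarrow> int \<times> int \<Rightarrow> (int \<times> int) set" where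
  "basin u v q = {p. \<exists>n. walk u v p n \<in> {q, step u v q}}"

lemma walk_Suc_shift: "walk u v p (Suc n) = walk u v (step u v p) n"
  by (simp add: funpow_swap1)

lemma walk_trapped:
  assumes "trapped u v q"
  shows "walk u v q n \<in> {q, step u v q}"
  by (induction n) (use assms in \<open>auto simp: trapped_def\<close>)

lemma basin_closed:
  assumes "trapped u v q"
  shows "step u v p \<in> basin u v q \<longleftrightarrow> p \<in> basin u v q"
proof
  assume "step u v p \<in> basin u v q"
  then obtain n where "walk u v (step u v p) n \<in> {q, step u v q}" by (auto simp: basin_def)
  then have "walk u v p (Suc n) \<in> {q, step u v q}" by (simp only: walk_Suc_shift)
  then show "p \<in> basin u v q" unfolding basin_def by blast
next
  assume "p \<in> basin u v q"
  then obtain n where n: "walk u v p n \<in> {q, step u v q}" by (auto simp: basin_def)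
  then have "walk u v (step u v p) n \<in> {q, step u v q}"
    using assms walk_Suc_shift[of n u v p] by (auto simp: trapped_def)
  then show "step u v p \<in> basin u v q" unfolding basin_def by blast
qed

text \<open>On its way into \<open>{q, step u v q}\<close> the walk meets its first trapped vertex, which it could leave only
  towards the other vertex of the same trap. So this first vertex is \<open>q\<close> or \<open>step u v q\<close>.\<close>

lemma basin_subset_first_trapped:
  assumes q: "trapped u v q"
  shows "basin u v q \<subseteq> {p. first_trapped u v p q} \<union> {p. first_trapped u v p (step u v q)}"
proof
  fix p
  assume "p \<in> basin u v q"
  then obtain n where n: "walk u v p n \<in> {q, step u v q}" by (auto simp: basin_def)
  with q trapped_stays[OF q] have tr: "trapped u v (walk u v p n)" by auto
  from ex_first_trapped[OF this] obtain r where r: "first_trapped u v p r" by blast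
  then obtain m where m: "walk u v p m = r" "trapped u v r" "\<forall>k<m. \<not> trapped u v (walk u v p k)"
    by (auto simp: first_trapped_def)
  with tr have "m \<le> n" using linorder_not_less by blast
  then have "walk u v p n = walk u v r (n - m)"
    using walk_add[where s = m and t = "n - m" and u = u and v = v and p = p] m(1) by simp
  with walk_trapped[OF m(2)] have "walk u v p n \<in> {r, step u v r}" by simp
  then have "{q, step u v q} \<inter> {r, step u v r} \<noteq> {}" using n by blast
  moreover have "step u v (step u v q) = q" "step u v (step u v r) = r"
    using q m(2) by (simp_all add: trapped_def)
  moreover from calculation(1) have "q = r \<or> q = step u v r \<or> step u v q = r \<or> step u v q = step u v r"
    by blast
  ultimately have "r = q \<or> r = step u v q" by metis
  with r show "p \<in> {p. first_trapped u v p q} \<union> {p. first_trapped u v p (step u v q)}" by auto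
qed

lemma parcs_lattice_digraph: "(a, b) \<in> parcs (lattice_digraph u v) \<longleftrightarrow> b = step u v a"
  by (cases a) (auto simp: lattice_digraph_def step_def)

lemma step_neq: "\<bar>u (snd p)\<bar> = 1 \<Longrightarrow> step u v p \<noteq> p"
  by (auto simp: step_def prod_eq_iff)

text \<open>All vertices of a component are led by the walk into the same trap \<open>{q, step u v q}\<close>, because this
  property is shared by the two ends of any arc. There are only finitely many such vertices, and a trap
  within the component must meet \<open>{q, step u v q}\<close>, hence equals it.\<close>

lemma component_bounded_one_trap:
  assumes u: "\<And>y. \<bar>u y\<bar> = 1"
    and trap: "\<And>p. \<exists>n. trapped u v (walk u v p n)"
    and fin: "\<And>q. finite {p. first_trapped u v p q}"
    and H: "H \<in> digraph_components (lattice_digraph u v)"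
  shows "bounded (map_prod real_of_int real_of_int ` verts H)
    \<and> (\<exists>!T. T \<in> traps (lattice_digraph u v) \<and> T \<subseteq> arcs H)"
proof -
  let ?s = "step u v"
  have "Digraph_Component.connected H" and sub: "subgraph H (with_proj (lattice_digraph u v))"
    using H by (auto simp: digraph_components_def pre_digraph.max_subgraph_def)
  then obtain p where p: "p \<in> verts H"
    by (auto simp: Digraph_Component.connected_def strongly_connected_def)
  have out: "?s a \<in> verts H" "(a, ?s a) \<in> arcs H" if "a \<in> verts H" for a
    using component_contains_outgoing_arc[OF H that] by (simp_all add: parcs_lattice_digraph)
  have walk: "walk u v p n \<in> verts H" for n
    by (induction n) (simp_all add: p out)
  obtain q n where q: "trapped u v q" "walk u v p n = q" using trap[of p] by blast
  have qH: "q \<in> verts H" using walk q by blast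
  have basin: "verts H \<subseteq> basin u v q"
  proof (rule component_subset_closed[OF H qH])
    show "q \<in> basin u v q" unfolding basin_def by (auto intro: exI[of _ 0])
  qed (simp add: parcs_lattice_digraph basin_closed[OF q(1)])
  have "finite (verts H)"
    by (rule finite_subset[OF subset_trans[OF basin basin_subset_first_trapped[OF q(1)]]])
      (simp add: fin)
  then have "bounded (map_prod real_of_int real_of_int ` verts H)"
    by (intro finite_imp_bounded finite_imageI)
  moreover have "\<exists>!T. T \<in> traps (lattice_digraph u v) \<and> T \<subseteq> arcs H"
  proof (rule ex1I[of _ "{(q, ?s q), (?s q, q)}"])
    have "q \<noteq> ?s q" "?s (?s q) = q"
      using q(1) step_neq[where u = u and v = v and p = q, OF u] by (simp_all add: trapped_def)
    then have "{(q, ?s q), (?s q, q)} \<in> traps (lattice_digraph u v)"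
      unfolding traps_def mem_Collect_eq
      by (intro exI[of _ q] exI[of _ "?s q"]) (simp add: parcs_lattice_digraph)
    moreover have "{(q, ?s q), (?s q, q)} \<subseteq> arcs H"
      using out[OF qH] out[OF out(1)[OF qH]] \<open>?s (?s q) = q\<close> by simp
    ultimately show "{(q, ?s q), (?s q, q)} \<in> traps (lattice_digraph u v)
      \<and> {(q, ?s q), (?s q, q)} \<subseteq> arcs H" ..
  next
    fix T
    assume T: "T \<in> traps (lattice_digraph u v) \<and> T \<subseteq> arcs H"
    then obtain a b where ab: "T = {(a, b), (b, a)}" "(a, b) \<in> parcs (lattice_digraph u v)"
      "(b, a) \<in> parcs (lattice_digraph u v)"
      unfolding traps_def by blast
    then have ba: "b = ?s a" "a = ?s b" by (simp_all only: parcs_lattice_digraph)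
    have "(a, b) \<in> arcs H" using T ab(1) by auto
    moreover have "wf_digraph H" "tail H = fst" using sub by (auto simp: subgraph_def compatible_def)
    ultimately have "a \<in> verts H" by (metis fst_conv wf_digraph.tail_in_verts)
    then obtain n where n: "walk u v a n \<in> {q, ?s q}" using basin by (auto simp: basin_def)
    have "trapped u v a" unfolding trapped_def by (simp only: ba[symmetric])
    from walk_trapped[OF this, of n] have "walk u v a n \<in> {a, b}" by (simp only: ba(1))
    then have "{a, b} \<inter> {q, ?s q} \<noteq> {}" using n by (metis IntI empty_iff)
    then have "a = q \<or> a = ?s q \<or> b = q \<or> b = ?s q" by blast
    moreover have "?s (?s q) = q" using q(1) by (simp add: trapped_def)
    ultimately have "a = q \<and> b = ?s q \<or> b = q \<and> a = ?s q" using ba by metis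
    then show "T = {(q, ?s q), (?s q, q)}" using ab(1) by auto
  qed
  ultimately show ?thesis ..
qed

lemma AE_components:
  "AE e in coin_tosses. \<forall>H \<in> digraph_components (lattice_digraph (\<lambda>y. e (Inl y)) (\<lambda>x. e (Inr x))).
    bounded (map_prod real_of_int real_of_int ` verts H)
    \<and> (\<exists>!T. T \<in> traps (lattice_digraph (\<lambda>y. e (Inl y)) (\<lambda>x. e (Inr x))) \<and> T \<subseteq> arcs H)"
  using AE_toss_abs AE_eventually_trapped AE_finite_first_trapped
proof eventually_elim
  case (elim e)
  show ?case by (intro ballI component_bounded_one_trap) (use elim in blast)+
qed

section \<open>Transfer to the given random variables\<close>

lemma (in prob_space) distr_coin:
  assumes X: "X \<in> M \<rightarrow>\<^sub>M count_space UNIV"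
    and "prob {w \<in> space M. X w = 1} = 1/2" "prob {w \<in> space M. X w = -1} = 1/2"
  shows "distr M (count_space UNIV) X = measure_pmf coin"
proof -
  have *: "measure (distr M (count_space UNIV) X) {z} = 1/2" if "z \<in> {-1, 1}" for z
    using that assms by (auto simp: measure_distr vimage_def Int_def conj_commute)
  interpret D: prob_space "distr M (count_space UNIV) X" by (rule prob_space_distr) (rule X)
  have "measure (distr M (count_space UNIV) X) {-1, 1} = 1"
    using D.finite_measure_eq_sum_singleton[of "{-1, 1}"] by (simp add: *)
  then have "AE z in distr M (count_space UNIV) X. z \<in> {-1, 1}"
    by (rule D.AE_prob_1)
  moreover have "AE z in measure_pmf coin. z \<in> {-1, 1}"
    by (simp add: AE_measure_pmf_iff)
  moreover have "emeasure (distr M (count_space UNIV) X) {z} = emeasure (measure_pmf coin) {z}"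
    if "z \<in> {-1, 1}" for z
    using that by (simp add: D.emeasure_eq_measure * emeasure_pmf_single)
  ultimately show ?thesis
    by (intro measure_eqI_countable_AE[where \<Omega> = "{-1, 1}"]) simp_all
qed

theorem theorem2:
  fixes M :: "'w measure" and U V :: "int \<Rightarrow> 'w \<Rightarrow> int"
  assumes "prob_space M"
    and "prob_space.indep_vars M (\<lambda>_. count_space {-1, 1}) (case_sum U V) UNIV"
    and "\<And>y. \<P>(w in M. U y w = 1) = 1/2" "\<And>y. \<P>(w in M. U y w = -1) = 1/2"
    and "\<And>x. \<P>(w in M. V x w = 1) = 1/2" "\<And>x. \<P>(w in M. V x w = -1) = 1/2"
  shows "AE w in M.
    let G = lattice_digraph (\<lambda>y. U y w) (\<lambda>x. V x w) in
      \<forall>H \<in> digraph_components G. bounded (map_prod real_of_int real_of_int ` verts H)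
        \<and> (\<exists>!T. T \<in> traps G \<and> T \<subseteq> arcs H)"
proof -
  interpret prob_space M by (rule assms)
  define X where "X = case_sum U V"
  have X: "X i \<in> M \<rightarrow>\<^sub>M count_space {-1, 1}" for i
    using assms(2) unfolding X_def indep_vars_def by simp
  have "indep_vars (\<lambda>_. count_space UNIV) (\<lambda>i w. X i w) UNIV"
    using assms(2) unfolding X_def by (rule indep_vars_compose2) simp
  moreover have Xu: "X i \<in> M \<rightarrow>\<^sub>M count_space UNIV" for i
    by (rule measurable_compose[OF X]) simp
  ultimately have "distr M (PiM UNIV (\<lambda>_. count_space UNIV)) (\<lambda>w i. X i w)
    = PiM UNIV (\<lambda>i. distr M (count_space UNIV) (X i))"
    by (subst (asm) indep_vars_iff_distr_eq_PiM) (simp_all add: restrict_def)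
  also have "\<dots> = coin_tosses"
    unfolding coin_tosses_def
    by (intro arg_cong2[where f = PiM] refl ext distr_coin Xu) (simp_all add: X_def assms split: sum.splits)
  finally have law: "distr M (PiM UNIV (\<lambda>_. count_space UNIV)) (\<lambda>w i. X i w) = coin_tosses" .
  have "(\<lambda>w i. X i w) \<in> M \<rightarrow>\<^sub>M PiM UNIV (\<lambda>_. count_space UNIV)"
    by (rule measurable_PiM_single') (simp_all add: Xu)
  from AE_distrD[OF this, unfolded law, OF AE_components] show ?thesis
    by (simp add: X_def Let_def)
qed

end
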